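(* Let $a<b$, and let $f:[a,b]\to\mathbb{R}$ be differentiable with $f(a)>0$ and $|f'(x)-f'(y)|\le L|x-y|$ for all $x,y\in[a,b]$, where $0<L<\infty$. Let $K$ be a constant with $L\le K<\infty$, and let $\{x^n\}$ be the infinite sequence of trial points generated by algorithm A1 (described in the context) with constant $K$ and stopping tolerance $\sigma=0$. If $f$ has a root in $[a,b]$, so that the point $x^*=\min\{x\in[a,b]: f(x)=0\}$ exists, then $x^*$ is the unique limit point (accumulation point) of the sequence $\{x^n\}$.
   Context: Algorithm A1. The search starts from finitely many (at least two) initial trial points that include $a$ and $b$. A trial at a point $x$ means evaluating $f(x)$ and $f'(x)$. Suppose trials have been made at $x^1,\dots,x^n$, $n\ge 2$. The next trial point $x^{n+1}$ is chosen as follows. Step 1 (ordering). Arrange the distinct trial points in increasing order $a=x_1<x_2<\dots<x_N=b$ (subscripts give the position in this order, which depends on $n$; $N=n$ if no point is repeated). Put $z_i=f(x_i)$, $z_i'=f'(x_i)$ and $k=\min(\{N\}\cup\{i: f(x_i)<0,\ 1<i\le N\})$. Only the intervals $[x_{i-1},x_i]$, $1<i\le k$, are considered. Step 2. Put $m_i=K$ for all $i$, $1<i\le k$. Auxiliary functions. For $1<i\le k$ let $$q_i=\frac{z_{i-1}-z_i+z_i'x_i-z_{i-1}'x_{i-1}+0.5m_i(x_i^2-x_{i-1}^2)}{m_i(x_i-x_{i-1})+z_i'-z_{i-1}'},$$ $$y_i=\frac{x_i-x_{i-1}}{4}+\frac{z_i'-z_{i-1}'}{4m_i}+q_i,\qquad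 y_i'=-\frac{x_i-x_{i-1}}{4}-\frac{z_i'-z_{i-1}'}{4m_i}+q_i,$$ $$b_i=z_i'-2m_iy_i+m_ix_i,\qquad c_i=z_i-z_i'x_i-0.5m_ix_i^2+m_iy_i^2,$$ $$\phi_i(x)=\begin{cases} z_{i-1}+z_{i-1}'(x-x_{i-1})-0.5m_i(x-x_{i-1})^2, & x\in[x_{i-1},y_i'],\\ 0.5m_ix^2+b_ix+c_i, & x\in(y_i',y_i],\\ z_i-z_i'(x_i-x)-0.5m_i(x_i-x)^2, & x\in(y_i,x_i],\end{cases}$$ and $\widehat x_i=2y_i-z_i'm_i^{-1}-x_i$ (the zero of the derivative of the middle quadratic). The quantities in these formulas are understood to be defined at every iteration. Step 3 (characteristics). For $i=2,3,\dots$ in increasing order, while $i\le k$: if $\phi_i'(y_i')\phi_i'(y_i)\ge 0$, let $h_i$ be whichever of $x_{i-1},x_i$ gives the smaller value of $f$, put $R_i=\phi_i(h_i)$, and say $i\in Y$ if $h_i=x_i$ and $i\in Y'$ otherwise; if $\phi_i'(y_i')\phi_i'(y_i)<0$, let $h_i$ be the point among $x_{i-1},\widehat x_i,x_i$ with the smallest value of $\phi_i$, put $R_i=\phi_i(h_i)$, and say $i\in I$. If $R_i\le 0$, go immediately to Step 5 with this $i$; otherwise pass to $i+1$. If all $R_i>0$, $1<i\le k$, go to Step 4. Step 4. Choose $i$ with $R_i=\min\{R_j:1<j\le k\}$ (no tie-breaking rule is specified) and set $x^{n+1}=y_i'$ if $i\in Y'$, $x^{n+1}=\widehat x_i$ if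 $i\in I$, $x^{n+1}=y_i$ if $i\in Y$. Go to Step 6. Step 5 ($R_i\le 0$). Consider the three candidate points (A) $x_{i-1}+\frac1{m_i}\left(z_{i-1}'+\sqrt{(z_{i-1}')^2+2m_iz_{i-1}}\right)$, (B) $x_i+\frac1{m_i}\left(z_i'+\sqrt{(z_i')^2+2m_iz_i}\right)$, (C) $\frac{-b_i-\sqrt{b_i^2-2m_ic_i}}{m_i}$. If $\phi_i(y_i')\le 0$, take $x^{n+1}$ to be (A). If $\phi_i(y_i')>0$ and $\phi_i'(y_i')\phi_i'(y_i)<0$, take (B) when $\phi_i(\widehat x_i)>0$ and (C) when $\phi_i(\widehat x_i)\le 0$. If $\phi_i(y_i')>0$ and $\phi_i'(y_i')\phi_i'(y_i)\ge 0$, take (B) when $\phi_i(y_i)>0$ and (C) when $\phi_i(y_i)\le 0$. Go to Step 6. Step 6 (stopping rule). Stop if $|x_i-x_{i-1}|\le\sigma$ for the selected $i$. Otherwise make a trial at $x^{n+1}$, replace $n$ by $n+1$ and return to Step 1. With $\sigma=0$ an infinite sequence $\{x^n\}$ is generated. *)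

theory Defs
  imports "HOL-Analysis.Analysis"
begin

section \<open>The piecewise quadratic support function on one interval\<close>

text \<open>
  In this section \<open>u < v\<close> are the end points of one interval, that is
  \<open>x\<^sub>i\<^sub>-\<^sub>1\<close> and \<open>x\<^sub>i\<close>, \<open>f'\<close> is the derivative of \<open>f\<close>, and \<open>m\<close> is the constant \<open>m\<^sub>i\<close>.
\<close>

definition q_denom :: "(real \<Rightarrow> real) \<Rightarrow> real \<Rightarrow> real \<Rightarrow> real \<Rightarrow> real" where
  "q_denom f' m u v = m * (v - u) + f' v - f' u"

definition q_mid :: "(real \<Rightarrow> real) \<Rightarrow> (real \<Rightarrow> real) \<Rightarrow> real \<Rightarrow> real \<Rightarrow> real \<Rightarrow> real" where
  "q_mid f f' m u v =
     (f u - f v + f' v * v - f' u * u + 1/2 * m * (v\<^sup>2 - u\<^sup>2)) / q_denom f' m u v"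

definition y_right :: "(real \<Rightarrow> real) \<Rightarrow> (real \<Rightarrow> real) \<Rightarrow> real \<Rightarrow> real \<Rightarrow> real \<Rightarrow> real" where
  "y_right f f' m u v = (v - u) / 4 + (f' v - f' u) / (4 * m) + q_mid f f' m u v"

definition y_left :: "(real \<Rightarrow> real) \<Rightarrow> (real \<Rightarrow> real) \<Rightarrow> real \<Rightarrow> real \<Rightarrow> real \<Rightarrow> real" where
  "y_left f f' m u v = - ((v - u) / 4) - (f' v - f' u) / (4 * m) + q_mid f f' m u v"

definition b_coeff :: "(real \<Rightarrow> real) \<Rightarrow> (real \<Rightarrow> real) \<Rightarrow> real \<Rightarrow> real \<Rightarrow> real \<Rightarrow> real" where
  "b_coeff f f' m u v = f' v - 2 * m * y_right f f' m u v + m * v"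

definition c_coeff :: "(real \<Rightarrow> real) \<Rightarrow> (real \<Rightarrow> real) \<Rightarrow> real \<Rightarrow> real \<Rightarrow> real \<Rightarrow> real" where
  "c_coeff f f' m u v = f v - f' v * v - 1/2 * m * v\<^sup>2 + m * (y_right f f' m u v)\<^sup>2"

text \<open>
  The two outer pieces are continued by the same formulas outside \<open>[u, v]\<close>, so that \<open>deriv\<close>
  is also the intended (one-sided) derivative where a break point coincides with an end point.
\<close>

definition phi :: "(real \<Rightarrow> real) \<Rightarrow> (real \<Rightarrow> real) \<Rightarrow> real \<Rightarrow> real \<Rightarrow> real \<Rightarrow> real \<Rightarrow> real" where
  "phi f f' m u v x =
     (if x \<le> y_left f f' m u v then f u + f' u * (x - u) - 1/2 * m * (x - u)\<^sup>2
      else if x \<le> y_right f f' m u v then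
        1/2 * m * x\<^sup>2 + b_coeff f f' m u v * x + c_coeff f f' m u v
      else f v - f' v * (v - x) - 1/2 * m * (v - x)\<^sup>2)"

definition x_hat :: "(real \<Rightarrow> real) \<Rightarrow> (real \<Rightarrow> real) \<Rightarrow> real \<Rightarrow> real \<Rightarrow> real \<Rightarrow> real" where
  "x_hat f f' m u v = 2 * y_right f f' m u v - f' v / m - v"

definition sign_change :: "(real \<Rightarrow> real) \<Rightarrow> (real \<Rightarrow> real) \<Rightarrow> real \<Rightarrow> real \<Rightarrow> real \<Rightarrow> bool" where
  "sign_change f f' m u v \<longleftrightarrow>
     deriv (phi f f' m u v) (y_left f f' m u v) * deriv (phi f f' m u v) (y_right f f' m u v) < 0"

text \<open>
  \<open>h\<close> is a legitimate choice of \<open>h\<^sub>i\<close>; it is a relation because ties may be broken arbitrarily.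
\<close>

definition is_h :: "(real \<Rightarrow> real) \<Rightarrow> (real \<Rightarrow> real) \<Rightarrow> real \<Rightarrow> real \<Rightarrow> real \<Rightarrow> real \<Rightarrow> bool" where
  "is_h f f' m u v h \<longleftrightarrow>
     (if sign_change f f' m u v
      then is_arg_min (phi f f' m u v) (\<lambda>w. w \<in> {u, x_hat f f' m u v, v}) h
      else is_arg_min f (\<lambda>w. w \<in> {u, v}) h)"

definition step4_point ::
  "(real \<Rightarrow> real) \<Rightarrow> (real \<Rightarrow> real) \<Rightarrow> real \<Rightarrow> real \<Rightarrow> real \<Rightarrow> real \<Rightarrow> real" where
  "step4_point f f' m u v h =
     (if sign_change f f' m u v then x_hat f f' m u v
      else if h = v then y_right f f' m u v
      else y_left f f' m u v)"

definition step5_point ::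
  "(real \<Rightarrow> real) \<Rightarrow> (real \<Rightarrow> real) \<Rightarrow> real \<Rightarrow> real \<Rightarrow> real \<Rightarrow> real" where
  "step5_point f f' m u v =
     (let A = u + 1 / m * (f' u + sqrt ((f' u)\<^sup>2 + 2 * m * f u));
          B = v + 1 / m * (f' v + sqrt ((f' v)\<^sup>2 + 2 * m * f v));
          C = (- b_coeff f f' m u v
               - sqrt ((b_coeff f f' m u v)\<^sup>2 - 2 * m * c_coeff f f' m u v)) / m
      in if phi f f' m u v (y_left f f' m u v) \<le> 0 then A
         else if sign_change f f' m u v then
           (if phi f f' m u v (x_hat f f' m u v) > 0 then B else C)
         else
           (if phi f f' m u v (y_right f f' m u v) > 0 then B else C))"


section \<open>The algorithm\<close>

text \<open>
  \<open>T\<close> is the finite set of points at which trials have been made; positions are counted from 1,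
  as in \<open>x\<^sub>1 < \<dots> < x\<^sub>N\<close>.
\<close>

definition pt :: "real set \<Rightarrow> nat \<Rightarrow> real" where
  "pt T i = sorted_list_of_set T ! (i - 1)"

definition k_index :: "(real \<Rightarrow> real) \<Rightarrow> real set \<Rightarrow> nat" where
  "k_index f T = Min ({card T} \<union> {i. f (pt T i) < 0 \<and> 1 < i \<and> i \<le> card T})"

text \<open>
  \<open>A1_next f f' K T i p\<close>: from the trial points \<open>T\<close> the algorithm may select the interval
  \<open>[x\<^sub>i\<^sub>-\<^sub>1, x\<^sub>i]\<close> and the next trial point \<open>p\<close>.  The first alternative is the exit to Step 5
  at the first nonpositive characteristic, the second one is Step 4.
\<close>

definition A1_next ::
  "(real \<Rightarrow> real) \<Rightarrow> (real \<Rightarrow> real) \<Rightarrow> real \<Rightarrow> real set \<Rightarrow> nat \<Rightarrow> real \<Rightarrow> bool" where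
  "A1_next f f' K T i p \<longleftrightarrow>
     (\<exists>m h R :: nat \<Rightarrow> real.
        (\<forall>j\<in>{2..k_index f T}.
           m j = K \<and>
           is_h f f' (m j) (pt T (j - 1)) (pt T j) (h j) \<and>
           R j = phi f f' (m j) (pt T (j - 1)) (pt T j) (h j)) \<and>
        i \<in> {2..k_index f T} \<and>
        (((\<forall>j\<in>{2..<i}. R j > 0) \<and> R i \<le> 0 \<and>
            p = step5_point f f' (m i) (pt T (i - 1)) (pt T i))
         \<or>
         ((\<forall>j\<in>{2..k_index f T}. R j > 0) \<and> (\<forall>j\<in>{2..k_index f T}. R i \<le> R j) \<and>
            p = step4_point f f' (m i) (pt T (i - 1)) (pt T i) (h i))))"

text \<open>
  \<open>X\<close> is an infinite sequence of trial points generated on \<open>[a, b]\<close> with constant \<open>K\<close> and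
  stopping tolerance \<open>\<sigma>\<close>.  The sequence is indexed from 0: \<open>X 0, \<dots>, X (n - 1)\<close> are the first
  \<open>n\<close> trials and \<open>X n\<close> is the one chosen next.  The first \<open>n0\<close> trials are the given ones.
  As division is total, definedness of the auxiliary quantities (for \<open>K > 0\<close>) has to be
  required explicitly, as \<open>q_denom \<noteq> 0\<close>.
\<close>

definition A1_sequence ::
  "(real \<Rightarrow> real) \<Rightarrow> (real \<Rightarrow> real) \<Rightarrow> real \<Rightarrow> real \<Rightarrow> real \<Rightarrow> real \<Rightarrow> (nat \<Rightarrow> real) \<Rightarrow> bool" where
  "A1_sequence f f' a b K \<sigma> X \<longleftrightarrow>
     (\<exists>n0\<ge>2.
        {a, b} \<subseteq> X ` {..<n0} \<and> X ` {..<n0} \<subseteq> {a..b} \<and>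
        (\<forall>n\<ge>n0.
           let T = X ` {..<n} in
             (\<forall>i\<in>{2..k_index f T}. q_denom f' K (pt T (i - 1)) (pt T i) \<noteq> 0) \<and>
             (\<exists>i. A1_next f f' K T i (X n) \<and> \<not> \<bar>pt T i - pt T (i - 1)\<bar> \<le> \<sigma>)))"

definition seq_limit_points :: "(nat \<Rightarrow> real) \<Rightarrow> real set" where
  "seq_limit_points X = {l. \<exists>r :: nat \<Rightarrow> nat. strict_mono r \<and> (X \<circ> r) \<longlonglongrightarrow> l}"

end

theory Submission
  imports Defs
begin

text \<open>
  Write \<open>x\<^sup>*\<close> for the first root of \<open>f\<close>, and consider one interval \<open>[u, v]\<close> between consecutive
  trial points.  On it \<open>phi\<close> is the smallest function that shares the values and slopes of \<open>f\<close> at the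
  two ends and whose derivative has Lipschitz constant \<open>K\<close>: two concave parabolas of
  curvature \<open>-K\<close> leave the ends and are joined, with matching slopes, by a convex parabola of
  curvature \<open>K\<close>.  Three properties of it carry the proof.

  \<^item> \<open>phi \<le> f\<close> on \<open>[u, v]\<close> (\<open>phi_le_f\<close>), and the characteristic \<open>R\<close> is the minimum of \<open>phi\<close>
    there (\<open>characteristic_le_phi\<close>).  So the interval that contains \<open>x\<^sup>*\<close> has \<open>R \<le> 0\<close>, Step 4 is
    never reached, and the selected interval starts to the left of \<open>x\<^sup>*\<close>.
  \<^item> The point produced by Step 5 is the first zero of \<open>phi\<close> (\<open>step5_point_is_first_zero\<close>).  As \<open>f\<close>
    is positive wherever \<open>phi\<close> is, every new trial point is at most \<open>x\<^sup>*\<close>.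
  \<^item> \<open>f\<close> exceeds \<open>phi\<close> by at most \<open>K\<close> times the squared distance to either end (\<open>f_minus_phi_le\<close>).
    At a zero \<open>p\<close> of \<open>phi\<close> this reads \<open>f p \<le> K (p - t)\<^sup>2\<close> for every earlier trial point \<open>t\<close>.

  To the left of \<open>x\<^sup>* - \<epsilon>\<close> the function \<open>f\<close> is bounded below by a positive number, so by the last
  property the new trial points lying there are uniformly separated from each other; a bounded
  interval has room for only finitely many of them.  Hence the sequence converges to \<open>x\<^sup>*\<close>.
\<close>

section \<open>Functions with Lipschitz derivative\<close>

lemma lipschitz_derivative_upper_bound:
  fixes f f' :: "real \<Rightarrow> real"
  assumes der: "\<And>z. z \<in> {a..b} \<Longrightarrow> (f has_real_derivative f' z) (at z within {a..b})"
    and lip: "\<And>y z. y \<in> {a..b} \<Longrightarrow> z \<in> {a..b} \<Longrightarrow> \<bar>f' y - f' z\<bar> \<le> m * \<bar>y - z\<bar>"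
    and x: "x \<in> {a..b}" and y: "y \<in> {a..b}"
  shows "f y \<le> f x + f' x * (y - x) + m / 2 * (y - x)\<^sup>2"
proof -
  define g where "g z = f z - f' x * (z - x) - m / 2 * (z - x)\<^sup>2" for z
  have dg: "(g has_real_derivative f' z - f' x - m * (z - x)) (at z)" if "a < z" "z < b" for z
  proof -
    have "(f has_real_derivative f' z) (at z)"
      using der[of z] that by (simp add: at_within_Icc_at)
    then show ?thesis
      unfolding g_def by (auto intro!: derivative_eq_intros)
  qed
  have "continuous_on {a..b} f"
    using der by (meson DERIV_continuous continuous_on_eq_continuous_within)
  then have cg: "continuous_on {a..b} g"
    unfolding g_def by (intro continuous_intros)
  have "g y \<le> g x"
  proof (cases "x \<le> y")
    case True
    show ?thesis
    proof (rule DERIV_nonpos_imp_decreasing_open[OF True])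
      fix z assume z: "x < z" "z < y"
      have "f' z - f' x - m * (z - x) \<le> 0"
        using lip[of z x] x y z by auto
      with dg[of z] x y z show "\<exists>d. (g has_real_derivative d) (at z) \<and> d \<le> 0"
        by fastforce
    next
      show "continuous_on {x..y} g"
        by (rule continuous_on_subset[OF cg]) (use x y in auto)
    qed
  next
    case False
    then have le: "y \<le> x" by simp
    show ?thesis
    proof (rule DERIV_nonneg_imp_increasing_open[OF le])
      fix z assume z: "y < z" "z < x"
      have "0 \<le> f' z - f' x - m * (z - x)"
        using lip[of z x] x y z by (auto simp: algebra_simps)
      with dg[of z] x y z show "\<exists>d. (g has_real_derivative d) (at z) \<and> 0 \<le> d"
        by fastforce
    next
      show "continuous_on {y..x} g"
        by (rule continuous_on_subset[OF cg]) (use x y in auto)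
    qed
  qed
  then show ?thesis by (simp add: g_def)
qed

lemma lipschitz_derivative_lower_bound:
  fixes f f' :: "real \<Rightarrow> real"
  assumes der: "\<And>z. z \<in> {a..b} \<Longrightarrow> (f has_real_derivative f' z) (at z within {a..b})"
    and lip: "\<And>y z. y \<in> {a..b} \<Longrightarrow> z \<in> {a..b} \<Longrightarrow> \<bar>f' y - f' z\<bar> \<le> m * \<bar>y - z\<bar>"
    and x: "x \<in> {a..b}" and y: "y \<in> {a..b}"
  shows "f x + f' x * (y - x) - m / 2 * (y - x)\<^sup>2 \<le> f y"
proof -
  have "- f y \<le> - f x + (- f' x) * (y - x) + m / 2 * (y - x)\<^sup>2"
  proof (rule lipschitz_derivative_upper_bound[of a b "\<lambda>z. - f z" "\<lambda>z. - f' z" m])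
    show "((\<lambda>z. - f z) has_real_derivative - f' z) (at z within {a..b})" if "z \<in> {a..b}" for z
      using der[OF that] by (rule DERIV_minus)
    show "\<bar>- f' y - - f' z\<bar> \<le> m * \<bar>y - z\<bar>" if "y \<in> {a..b}" "z \<in> {a..b}" for y z
      using lip[OF that] by linarith
  qed (use x y in auto)
  then show ?thesis by (simp add: algebra_simps)
qed

section \<open>Elementary facts on quadratics\<close>

lemma concave_quadratic_ge_ends:
  fixes \<alpha> \<beta> m s t :: real
  assumes "0 \<le> s" "s \<le> t" "0 \<le> m"
  shows "min \<alpha> (\<alpha> + \<beta> * t - m / 2 * t\<^sup>2) \<le> \<alpha> + \<beta> * s - m / 2 * s\<^sup>2"
proof (cases "\<beta> \<ge> m / 2 * s")
  case True
  then have "0 \<le> s * (\<beta> - m / 2 * s)"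
    using assms by simp
  then show ?thesis by (simp add: power2_eq_square algebra_simps min_le_iff_disj)
next
  case False
  have "m * s \<le> m * t" using assms by (simp add: mult_left_mono)
  moreover have "0 \<le> m * t" using assms by simp
  moreover have "m / 2 * (t + s) = m * t / 2 + m * s / 2" by (simp add: field_simps)
  ultimately have "\<beta> - m / 2 * (t + s) \<le> 0"
    using False by linarith
  then have "(t - s) * (\<beta> - m / 2 * (t + s)) \<le> 0"
    using assms by (intro mult_nonneg_nonpos) simp_all
  moreover have "\<alpha> + \<beta> * t - m / 2 * t\<^sup>2
      = \<alpha> + \<beta> * s - m / 2 * s\<^sup>2 + (t - s) * (\<beta> - m / 2 * (t + s))"
    by (simp add: power2_eq_square field_simps)
  ultimately have "\<alpha> + \<beta> * t - m / 2 * t\<^sup>2 \<le> \<alpha> + \<beta> * s - m / 2 * s\<^sup>2"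
    by linarith
  then show ?thesis by (simp add: min_le_iff_disj)
qed

text \<open>
  This criterion differentiates a piecewise function at a break point without comparing one-sided
  derivatives.
\<close>

lemma has_real_derivative_if_quadratic_error:
  fixes g :: "real \<Rightarrow> real"
  assumes "\<And>y. \<bar>g y - g x - d * (y - x)\<bar> \<le> M * (y - x)\<^sup>2"
  shows "(g has_real_derivative d) (at x)"
proof -
  have "((\<lambda>y. (g y - g x) / (y - x) - d) \<longlongrightarrow> 0) (at x)"
  proof (rule Lim_null_comparison)
    have "eventually (\<lambda>y. y \<noteq> x) (at x)" by (simp add: eventually_at_filter)
    then show "eventually (\<lambda>y. norm ((g y - g x) / (y - x) - d) \<le> M * \<bar>y - x\<bar>) (at x)"
    proof (rule eventually_mono)
      fix y assume "y \<noteq> x"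
      then have "(g y - g x) / (y - x) - d = (g y - g x - d * (y - x)) / (y - x)"
        by (simp add: field_simps)
      then have "norm ((g y - g x) / (y - x) - d) = \<bar>g y - g x - d * (y - x)\<bar> / \<bar>y - x\<bar>"
        by simp
      also have "\<dots> \<le> M * \<bar>y - x\<bar>"
        using \<open>y \<noteq> x\<close> assms[of y] by (simp add: divide_le_eq power2_eq_square algebra_simps flip: abs_mult)
      finally show "norm ((g y - g x) / (y - x) - d) \<le> M * \<bar>y - x\<bar>" .
    qed
    show "((\<lambda>y. M * \<bar>y - x\<bar>) \<longlongrightarrow> 0) (at x)"
      by (auto intro!: tendsto_eq_intros)
  qed
  then have "((\<lambda>y. (g y - g x) / (y - x)) \<longlongrightarrow> d) (at x)"
    by (simp add: LIM_zero_iff)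
  then show ?thesis by (simp add: has_field_derivative_iff)
qed

section \<open>The support function on one interval\<close>

locale trial_interval =
  fixes f f' :: "real \<Rightarrow> real" and m u v :: real
  assumes m_pos: "0 < m" and u_less_v: "u < v"
    and f_deriv: "\<And>z. z \<in> {u..v} \<Longrightarrow> (f has_real_derivative f' z) (at z within {u..v})"
    and f'_lipschitz: "\<And>y z. y \<in> {u..v} \<Longrightarrow> z \<in> {u..v} \<Longrightarrow> \<bar>f' y - f' z\<bar> \<le> m * \<bar>y - z\<bar>"
    and q_denom_nonzero: "q_denom f' m u v \<noteq> 0"
begin

abbreviation "yl \<equiv> y_left f f' m u v"
abbreviation "yr \<equiv> y_right f f' m u v"
abbreviation "xh \<equiv> x_hat f f' m u v"
abbreviation "\<phi> \<equiv> phi f f' m u v"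

text \<open>
  The parabolas are taken on the whole line, because the estimates below compare them with each
  other and with \<open>phi\<close> also outside their own piece.
\<close>

definition left_piece :: "real \<Rightarrow> real" where
  "left_piece x = f u + f' u * (x - u) - m / 2 * (x - u)\<^sup>2"

definition right_piece :: "real \<Rightarrow> real" where
  "right_piece x = f v + f' v * (x - v) - m / 2 * (x - v)\<^sup>2"

definition middle_piece :: "real \<Rightarrow> real" where
  "middle_piece x = m / 2 * x\<^sup>2 + b_coeff f f' m u v * x + c_coeff f f' m u v"

lemma taylor_upper:
  "x \<in> {u..v} \<Longrightarrow> y \<in> {u..v} \<Longrightarrow> f y \<le> f x + f' x * (y - x) + m / 2 * (y - x)\<^sup>2"
  by (rule lipschitz_derivative_upper_bound[of u v f f' m]) (use f_deriv f'_lipschitz in auto)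

lemma taylor_lower:
  "x \<in> {u..v} \<Longrightarrow> y \<in> {u..v} \<Longrightarrow> f x + f' x * (y - x) - m / 2 * (y - x)\<^sup>2 \<le> f y"
  by (rule lipschitz_derivative_lower_bound[of u v f f' m]) (use f_deriv f'_lipschitz in auto)

lemma q_denom_bounds: "0 < q_denom f' m u v" "q_denom f' m u v \<le> 2 * m * (v - u)"
proof -
  have "\<bar>f' v - f' u\<bar> \<le> m * (v - u)"
    using f'_lipschitz[of v u] u_less_v by simp
  then show "0 < q_denom f' m u v" "q_denom f' m u v \<le> 2 * m * (v - u)"
    using q_denom_nonzero by (auto simp: q_denom_def)
qed

lemma y_right_minus_y_left: "yr - yl = q_denom f' m u v / (2 * m)"
  using m_pos by (simp add: y_right_def y_left_def q_denom_def field_simps)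

lemma y_left_less_y_right: "yl < yr"
  using y_right_minus_y_left q_denom_bounds m_pos
  by (smt (verit) divide_pos_pos)

text \<open>
  The break points lie inside \<open>[u, v]\<close> because \<open>f\<close> itself obeys the Taylor bounds from both ends.
  The increase of \<open>f\<close> over the interval is largest when the slope first grows at rate \<open>m\<close> and then
  falls at rate \<open>m\<close>, the switch taking place at distance \<open>s = D / (2 m)\<close> from \<open>u\<close>, with \<open>D\<close> the
  denominator of \<open>q\<close>; the two Taylor bounds compared at that switch point give exactly
  \<open>u \<le> y_left\<close>.  The smallest increase, with the switch at distance \<open>s\<close> from \<open>v\<close>, gives
  \<open>y_right \<le> v\<close>.
\<close>

lemma u_le_y_left: "u \<le> yl"
proof -
  define s where "s = q_denom f' m u v / (2 * m)"
  have s: "0 \<le> s" "s \<le> v - u"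
    using q_denom_bounds m_pos by (auto simp: s_def field_simps)
  have D: "q_denom f' m u v = 2 * m * s"
    using m_pos by (simp add: s_def)
  then have f'u: "f' u = f' v + m * (v - u) - 2 * m * s"
    by (simp add: q_denom_def)
  have s0: "s > 0" using q_denom_bounds m_pos by (simp add: s_def)
  have "f (u + s) \<le> f u + f' u * s + m / 2 * s\<^sup>2"
    using taylor_upper[of u "u + s"] s by simp
  moreover have "f v + f' v * (u + s - v) - m / 2 * (u + s - v)\<^sup>2 \<le> f (u + s)"
    using taylor_lower[of v "u + s"] s by simp
  ultimately have "m * s\<^sup>2 \<le> f u - f v + f' v * (v - u) + m / 2 * (v - u)\<^sup>2"
    unfolding f'u by (simp add: power2_eq_square algebra_simps)
  also have "\<dots> = (q_mid f f' m u v - u) * (2 * m * s)"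
    using m_pos s0 unfolding q_mid_def D unfolding f'u
    by (simp add: field_simps power2_eq_square)
  finally have "m * s * (s / 2) \<le> m * s * (q_mid f f' m u v - u)"
    by (simp add: power2_eq_square algebra_simps)
  then have "s / 2 \<le> q_mid f f' m u v - u"
    using m_pos s0 by (subst (asm) mult_le_cancel_left_pos) auto
  moreover have "yl = q_mid f f' m u v - s / 2"
    using m_pos by (simp add: y_left_def f'u field_simps)
  ultimately show ?thesis by simp
qed

lemma y_right_le_v: "yr \<le> v"
proof -
  define s where "s = q_denom f' m u v / (2 * m)"
  have s: "0 \<le> s" "s \<le> v - u"
    using q_denom_bounds m_pos by (auto simp: s_def field_simps)
  have D: "q_denom f' m u v = 2 * m * s"
    using m_pos by (simp add: s_def)
  then have f'v: "f' v = f' u - m * (v - u) + 2 * m * s"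
    by (simp add: q_denom_def)
  have s0: "s > 0" using q_denom_bounds m_pos by (simp add: s_def)
  have "f (v - s) \<le> f v + f' v * (- s) + m / 2 * s\<^sup>2"
    using taylor_upper[of v "v - s"] s by simp
  moreover have "f u + f' u * (v - s - u) - m / 2 * (v - s - u)\<^sup>2 \<le> f (v - s)"
    using taylor_lower[of u "v - s"] s by simp
  ultimately have "m * s\<^sup>2 \<le> f v - f u - f' u * (v - u) + m / 2 * (v - u)\<^sup>2"
    unfolding f'v by (simp add: power2_eq_square algebra_simps)
  also have "\<dots> = (v - q_mid f f' m u v) * (2 * m * s)"
    using m_pos s0 unfolding q_mid_def D unfolding f'v
    by (simp add: field_simps power2_eq_square)
  finally have "m * s * (s / 2) \<le> m * s * (v - q_mid f f' m u v)"
    by (simp add: power2_eq_square algebra_simps)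
  then have "s / 2 \<le> v - q_mid f f' m u v"
    using m_pos s0 by (subst (asm) mult_le_cancel_left_pos) auto
  moreover have "yr = q_mid f f' m u v + s / 2"
    using m_pos by (simp add: y_right_def f'v field_simps)
  ultimately show ?thesis by simp
qed

text \<open>
  The middle parabola has curvature \<open>m\<close> and each outer one \<open>-m\<close>, and they touch at the break
  points; their differences are therefore \<open>m\<close> times a square.  For the right break point this is
  how \<open>b\<close> and \<open>c\<close> are chosen, for the left one it is what the value of \<open>q\<close> achieves.
\<close>

lemma middle_minus_right: "middle_piece x - right_piece x = m * (x - yr)\<^sup>2"
  by (simp add: middle_piece_def right_piece_def b_coeff_def c_coeff_def
      power2_eq_square algebra_simps)

lemma middle_minus_left: "middle_piece x - left_piece x = m * (x - yl)\<^sup>2"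
proof -
  define q where "q = q_mid f f' m u v"
  define D where "D = q_denom f' m u v"
  have f'v: "f' v = f' u - m * (v - u) + D"
    by (simp add: D_def q_denom_def)
  have qD: "q * D = f u - f v + f' v * v - f' u * u + 1/2 * m * (v\<^sup>2 - u\<^sup>2)"
    using q_denom_nonzero by (simp add: q_def q_mid_def D_def)
  have yr: "yr = q + D / (4 * m)" and yl: "yl = q - D / (4 * m)"
    using m_pos by (simp_all add: y_right_def y_left_def q_def f'v field_simps)
  have "m * (x - yr)\<^sup>2 - m * (x - yl)\<^sup>2 = D * (q - x)"
    unfolding yr yl using m_pos by (simp add: field_simps power2_eq_square)
  also have "\<dots> = left_piece x - right_piece x"
    using qD unfolding left_piece_def right_piece_def f'v
    by (simp add: power2_eq_square algebra_simps)
  finally show ?thesis using middle_minus_right[of x] by linarith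
qed

lemma phi_left: "x \<le> yl \<Longrightarrow> \<phi> x = left_piece x"
  by (simp add: phi_def left_piece_def)

lemma phi_middle: "yl \<le> x \<Longrightarrow> x \<le> yr \<Longrightarrow> \<phi> x = middle_piece x"
  using middle_minus_left[of yl]
  by (cases "x = yl") (auto simp: phi_left, simp add: phi_def middle_piece_def)

lemma phi_right: "yr \<le> x \<Longrightarrow> \<phi> x = right_piece x"
  using middle_minus_right[of yr] y_left_less_y_right
  by (cases "x = yr") (auto simp: phi_middle, simp add: phi_def right_piece_def algebra_simps power2_commute)

lemma phi_at_ends: "\<phi> u = f u" "\<phi> v = f v"
  using phi_left[OF u_le_y_left] phi_right[OF y_right_le_v]
  by (simp_all add: left_piece_def right_piece_def)

text \<open>
  On the outer pieces the minorant property is the lower Taylor bound from the nearer end.  On the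
  middle piece \<open>f - phi\<close> is concave, since the slope of \<open>f\<close> grows at rate at most \<open>m\<close>, and it is
  nonnegative at both break points.
\<close>

lemma phi_le_f:
  assumes x: "x \<in> {u..v}"
  shows "\<phi> x \<le> f x"
proof -
  have left: "left_piece z \<le> f z" and right: "right_piece z \<le> f z" if "z \<in> {u..v}" for z
    using taylor_lower[of u z] taylor_lower[of v z] that
    by (auto simp: left_piece_def right_piece_def)
  consider "x \<le> yl" | "yl \<le> x" "x \<le> yr" | "yr \<le> x" by linarith
  then show ?thesis
  proof cases
    case 2
    have ends: "yl \<in> {u..v}" "yr \<in> {u..v}"
      using u_le_y_left y_right_le_v y_left_less_y_right by auto
    (* d is the slope of f - middle_piece at x; moving from x against it leads to a break point
       where the gap is no larger than at x. *)
    define d where "d = f' x - (m * x + b_coeff f f' m u v)"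
    have expand: "middle_piece z = middle_piece x + (m * x + b_coeff f f' m u v) * (z - x)
        + m / 2 * (z - x)\<^sup>2" for z
      by (simp add: middle_piece_def power2_eq_square algebra_simps)
    have gap: "f z - middle_piece z \<le> f x - middle_piece x + d * (z - x)" if "z \<in> {u..v}" for z
      using taylor_upper[OF x that] expand[of z] by (simp add: d_def algebra_simps)
    have "0 \<le> f yl - middle_piece yl" "0 \<le> f yr - middle_piece yr"
      using left[OF ends(1)] right[OF ends(2)] middle_minus_left[of yl] middle_minus_right[of yr]
      by auto
    moreover have "d * (yl - x) \<le> 0 \<or> d * (yr - x) \<le> 0"
      using 2 by (cases "0 \<le> d") (auto simp: mult_le_0_iff)
    ultimately have "0 \<le> f x - middle_piece x"
      using gap[OF ends(1)] gap[OF ends(2)] by linarith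
    then show ?thesis using 2 by (simp add: phi_middle)
  qed (use x left right in \<open>auto simp: phi_left phi_right\<close>)
qed

lemma left_right_le_phi: "left_piece x \<le> \<phi> x" "right_piece x \<le> \<phi> x"
proof -
  have sq: "m * (x - yr)\<^sup>2 \<le> m * (x - yl)\<^sup>2" if "yr \<le> x"
    using that y_left_less_y_right m_pos by (simp add: power_mono)
  have sq': "m * (x - yl)\<^sup>2 \<le> m * (x - yr)\<^sup>2" if "x \<le> yl"
    using that y_left_less_y_right m_pos power_mono[of "yl - x" "yr - x" 2]
    by (simp add: power2_commute)
  have nn: "0 \<le> m * (x - yl)\<^sup>2" "0 \<le> m * (x - yr)\<^sup>2" using m_pos by simp_all
  consider "x \<le> yl" | "yl \<le> x" "x \<le> yr" | "yr \<le> x" by linarith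
  then have "left_piece x \<le> \<phi> x \<and> right_piece x \<le> \<phi> x"
    by cases (use nn sq sq' middle_minus_left[of x] middle_minus_right[of x] in
        \<open>auto simp: phi_left phi_middle phi_right\<close>)
  then show "left_piece x \<le> \<phi> x" "right_piece x \<le> \<phi> x" by auto
qed

text \<open>
  \<open>f\<close> and \<open>phi\<close> agree to first order at both ends, so their gap is at most quadratic in the distance
  to either end: \<open>f\<close> lies below the parabola of curvature \<open>m\<close> and \<open>phi\<close> above the one of curvature
  \<open>-m\<close> issuing from that end.
\<close>

lemma f_minus_phi_le:
  assumes "x \<in> {u..v}"
  shows "f x - \<phi> x \<le> m * (x - u)\<^sup>2" "f x - \<phi> x \<le> m * (x - v)\<^sup>2"
  using taylor_upper[of u x] taylor_upper[of v x] left_right_le_phi[of x] assms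
  by (auto simp: left_piece_def right_piece_def)

lemma middle_piece_vertex: "middle_piece x = middle_piece xh + m / 2 * (x - xh)\<^sup>2"
proof -
  have b: "b_coeff f f' m u v = - m * xh"
    using m_pos by (simp add: b_coeff_def x_hat_def field_simps)
  show ?thesis
    by (simp add: middle_piece_def b power2_eq_square algebra_simps)
qed

lemma phi_deriv_at_breaks:
  "deriv \<phi> yl = m * (yl - xh)" "deriv \<phi> yr = m * (yr - xh)"
proof -
  have err: "\<bar>\<phi> y - \<phi> x - m * (x - xh) * (y - x)\<bar> \<le> 2 * m * (y - x)\<^sup>2" if "x = yl \<or> x = yr" for x y
  proof -
    have mid: "\<phi> x = middle_piece x"
      using that y_left_less_y_right by (auto simp: phi_middle)
    have "middle_piece y - middle_piece x - m * (x - xh) * (y - x) = m / 2 * (y - x)\<^sup>2"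
      using middle_piece_vertex[of x] middle_piece_vertex[of y]
      by (simp add: power2_eq_square algebra_simps)
    moreover have "\<phi> y \<le> middle_piece y" "middle_piece y - m * (y - x)\<^sup>2 \<le> \<phi> y"
    proof -
      have nn: "0 \<le> m * (y - yl)\<^sup>2" "0 \<le> m * (y - yr)\<^sup>2" using m_pos by simp_all
      consider "y \<le> yl" | "yl \<le> y" "y \<le> yr" | "yr \<le> y" by linarith
      then show "\<phi> y \<le> middle_piece y"
        by cases (use nn middle_minus_left[of y] middle_minus_right[of y] in
            \<open>auto simp: phi_left phi_middle phi_right\<close>)
      show "middle_piece y - m * (y - x)\<^sup>2 \<le> \<phi> y"
        using that left_right_le_phi[of y] middle_minus_left[of y] middle_minus_right[of y] by auto
    qed
    moreover have "0 \<le> m * (y - x)\<^sup>2" using m_pos by simp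
    ultimately show ?thesis unfolding mid by linarith
  qed
  show "deriv \<phi> yl = m * (yl - xh)" "deriv \<phi> yr = m * (yr - xh)"
    by (auto intro!: DERIV_imp_deriv has_real_derivative_if_quadratic_error[where M = "2 * m"] err)
qed

text \<open>
  The sign test of the algorithm asks whether the vertex of the middle parabola lies strictly
  between the break points; otherwise \<open>phi\<close> is monotone on the middle piece.
\<close>

lemma sign_change_iff: "sign_change f f' m u v \<longleftrightarrow> yl < xh \<and> xh < yr"
proof -
  have "sign_change f f' m u v \<longleftrightarrow> (m * m) * ((yl - xh) * (yr - xh)) < 0"
    by (simp add: sign_change_def phi_deriv_at_breaks algebra_simps)
  also have "\<dots> \<longleftrightarrow> (yl - xh) * (yr - xh) < 0"
    using m_pos by (simp add: mult_less_0_iff)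
  finally show ?thesis
    using y_left_less_y_right by (auto simp: mult_less_0_iff)
qed

lemma phi_ge_ends_left:
  assumes "u \<le> x" "x \<le> yl"
  shows "min (f u) (\<phi> yl) \<le> \<phi> x"
  using concave_quadratic_ge_ends[of "x - u" "yl - u" m "f u" "f' u"] assms m_pos
  by (simp add: phi_left left_piece_def)

lemma phi_ge_ends_right:
  assumes "yr \<le> x" "x \<le> v"
  shows "min (f v) (\<phi> yr) \<le> \<phi> x"
  using concave_quadratic_ge_ends[of "v - x" "v - yr" m "f v" "- f' v"] assms m_pos
  by (simp add: phi_right right_piece_def algebra_simps power2_commute)

lemma phi_middle_mono:
  assumes "yl \<le> x" "x \<le> y" "y \<le> yr"
  shows "xh \<le> x \<Longrightarrow> \<phi> x \<le> \<phi> y" "y \<le> xh \<Longrightarrow> \<phi> y \<le> \<phi> x"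
proof -
  assume "xh \<le> x"
  then have "(x - xh)\<^sup>2 \<le> (y - xh)\<^sup>2" using assms by (intro power_mono) auto
  then have "m / 2 * (x - xh)\<^sup>2 \<le> m / 2 * (y - xh)\<^sup>2"
    using m_pos by (intro mult_left_mono) auto
  then show "\<phi> x \<le> \<phi> y"
    using assms middle_piece_vertex[of x] middle_piece_vertex[of y] by (auto simp: phi_middle)
next
  assume "y \<le> xh"
  then have "(xh - y)\<^sup>2 \<le> (xh - x)\<^sup>2" using assms by (intro power_mono) auto
  then have "m / 2 * (y - xh)\<^sup>2 \<le> m / 2 * (x - xh)\<^sup>2"
    using m_pos by (intro mult_left_mono) (auto simp: power2_commute)
  then show "\<phi> y \<le> \<phi> x"
    using assms middle_piece_vertex[of x] middle_piece_vertex[of y] by (auto simp: phi_middle)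
qed

lemma right_piece_antimono:
  assumes "yr \<le> xh" "yr \<le> x" "x \<le> y"
  shows "\<phi> y \<le> \<phi> x"
proof -
  have d: "right_piece z = middle_piece xh + m / 2 * (z - xh)\<^sup>2 - m * (z - yr)\<^sup>2" for z
    using middle_minus_right[of z] middle_piece_vertex[of z] by simp
  have "0 \<le> (y - x) * ((xh - yr) + (x - yr) / 2 + (y - yr) / 2)"
    using assms by (intro mult_nonneg_nonneg) auto
  then have "0 \<le> m * ((y - x) * ((xh - yr) + (x - yr) / 2 + (y - yr) / 2))"
    using m_pos by simp
  also have "\<dots> = right_piece x - right_piece y"
    unfolding d by (simp add: power2_eq_square field_simps)
  finally show ?thesis using assms by (simp add: phi_right)
qed

lemma left_piece_mono:
  assumes "xh \<le> yl" "x \<le> y" "y \<le> yl"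
  shows "\<phi> x \<le> \<phi> y"
proof -
  have d: "left_piece z = middle_piece xh + m / 2 * (z - xh)\<^sup>2 - m * (z - yl)\<^sup>2" for z
    using middle_minus_left[of z] middle_piece_vertex[of z] by simp
  have "0 \<le> (y - x) * ((yl - xh) + (yl - x) / 2 + (yl - y) / 2)"
    using assms by (intro mult_nonneg_nonneg) auto
  then have "0 \<le> m * ((y - x) * ((yl - xh) + (yl - x) / 2 + (yl - y) / 2))"
    using m_pos by simp
  also have "\<dots> = left_piece y - left_piece x"
    unfolding d by (simp add: power2_eq_square field_simps)
  finally show ?thesis using assms by (simp add: phi_left)
qed

lemma characteristic_eq:
  assumes "is_h f f' m u v h"
  shows "\<phi> h = (if sign_change f f' m u v then min (\<phi> xh) (min (f u) (f v)) else min (f u) (f v))"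
  using assms phi_at_ends
  by (auto simp: is_h_def is_arg_min_linorder split: if_splits)

text \<open>
  The outer pieces are concave, hence minimal at an end or at a break point.  The middle piece is
  minimal at its vertex or, if the vertex is outside, at the break point towards it, from which
  \<open>phi\<close> continues to fall until the end of the interval.  So the candidates compared in the
  definition of the characteristic contain a minimiser.
\<close>

lemma characteristic_le_phi:
  assumes "is_h f f' m u v h" "x \<in> {u..v}"
  shows "\<phi> h \<le> \<phi> x"
proof -
  have ends: "min (\<phi> yl) (f u) \<le> \<phi> x \<or> min (\<phi> yr) (f v) \<le> \<phi> x \<or> yl \<le> x \<and> x \<le> yr"
    using phi_ge_ends_left[of x] phi_ge_ends_right[of x] assms(2)
    by (cases "x \<le> yl"; cases "yr \<le> x") (auto simp: min.commute)
  have h: "\<phi> h \<le> f u" "\<phi> h \<le> f v" "sign_change f f' m u v \<Longrightarrow> \<phi> h \<le> \<phi> xh"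
    using characteristic_eq[OF assms(1)] by auto
  have mid: "\<phi> h \<le> \<phi> z" if z: "yl \<le> z" "z \<le> yr" for z
  proof (cases "sign_change f f' m u v")
    case True
    then have "\<phi> xh \<le> \<phi> z"
      using phi_middle_mono[of xh z] phi_middle_mono[of z xh] z unfolding sign_change_iff by linarith
    then show ?thesis using h(3)[OF True] by simp
  next
    case False
    then consider "xh \<le> yl" | "yr \<le> xh" by (auto simp: sign_change_iff)
    then show ?thesis
    proof cases
      case 1
      have "f u \<le> \<phi> yl"
        using left_piece_mono[OF 1, of u yl] u_le_y_left phi_at_ends by simp
      moreover have "\<phi> yl \<le> \<phi> z"
        using phi_middle_mono(1)[of yl z] 1 z by simp
      ultimately show ?thesis using h(1) by linarith
    next
      case 2
      have "f v \<le> \<phi> yr"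
        using right_piece_antimono[OF 2, of yr v] y_right_le_v phi_at_ends by simp
      moreover have "\<phi> yr \<le> \<phi> z"
        using phi_middle_mono(2)[of z yr] 2 z by simp
      ultimately show ?thesis using h(2) by linarith
    qed
  qed
  show ?thesis
    using ends h(1,2) mid[of yl] mid[of yr] mid[of x] y_left_less_y_right
    by (auto simp: min_le_iff_disj)
qed

lemma positive_up_to_y_left:
  assumes "0 < f u" "0 < \<phi> yl" "u \<le> x" "x \<le> yl"
  shows "0 < \<phi> x"
  using phi_ge_ends_left[of x] assms by linarith

text \<open>
  The three candidates of Step 5 are roots of the left, the right and the middle parabola.  In each
  case the parabola is factorised, and the signs at the break points, at the vertex or at the ends
  decide which of its two roots lies on the piece in question.
\<close>

lemma first_zero_on_left_piece:
  assumes fu: "0 < f u" and yl: "\<phi> yl \<le> 0"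
  defines "p \<equiv> u + 1 / m * (f' u + sqrt ((f' u)\<^sup>2 + 2 * m * f u))"
  shows "p \<in> {u..v} \<and> \<phi> p = 0 \<and> (\<forall>x\<in>{u..<p}. 0 < \<phi> x)"
proof -
  define r where "r = sqrt ((f' u)\<^sup>2 + 2 * m * f u)"
  define p' where "p' = u + 1 / m * (f' u - r)"
  have "0 < 2 * m * f u" using m_pos fu by simp
  then have r2: "r\<^sup>2 = (f' u)\<^sup>2 + 2 * m * f u" and "\<bar>f' u\<bar> < r"
    by (auto simp: r_def intro: real_less_rsqrt)
  then have p': "p' < u" and p: "u < p"
    using m_pos by (auto simp: p'_def p_def r_def[symmetric] divide_less_0_iff zero_less_divide_iff)
  have "2 * m * left_piece x = r\<^sup>2 - (m * (x - u) - f' u)\<^sup>2" for x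
    unfolding r2 by (simp add: left_piece_def power2_eq_square algebra_simps)
  also have "r\<^sup>2 - (m * (x - u) - f' u)\<^sup>2 = m\<^sup>2 * ((p - x) * (x - p'))" for x
    using m_pos unfolding p_def p'_def r_def[symmetric]
    by (simp add: power2_eq_square field_simps)
  finally have twice: "2 * m * left_piece x = 2 * m * (m / 2 * ((p - x) * (x - p')))" for x
    by (simp add: power2_eq_square)
  have fact: "left_piece x = m / 2 * ((p - x) * (x - p'))" for x
    using twice[of x] m_pos by simp
  have "(p - yl) * (yl - p') \<le> 0"
    using yl fact[of yl] m_pos by (simp add: phi_left mult_le_0_iff)
  then have "p \<le> yl"
    using p' u_le_y_left by (auto simp: mult_le_0_iff)
  moreover have "0 < left_piece x" if "u \<le> x" "x < p" for x
    unfolding fact using m_pos p' that by (intro mult_pos_pos) auto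
  moreover have "left_piece p = 0" by (simp add: fact)
  ultimately show ?thesis
    using p y_left_less_y_right y_right_le_v by (auto simp: phi_left)
qed

lemma first_zero_on_middle_piece:
  assumes fu: "0 < f u" and yl: "0 < \<phi> yl"
    and w: "yl < w" "w \<le> yr" "w \<le> xh" "\<phi> w \<le> 0"
  defines "p \<equiv> (- b_coeff f f' m u v
      - sqrt ((b_coeff f f' m u v)\<^sup>2 - 2 * m * c_coeff f f' m u v)) / m"
  shows "p \<in> {u..v} \<and> \<phi> p = 0 \<and> (\<forall>x\<in>{u..<p}. 0 < \<phi> x)"
proof -
  define D where "D = (b_coeff f f' m u v)\<^sup>2 - 2 * m * c_coeff f f' m u v"
  have b: "b_coeff f f' m u v = - m * xh"
    using m_pos by (simp add: b_coeff_def x_hat_def field_simps)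
  have sq: "2 * m * middle_piece x = (m * (x - xh))\<^sup>2 - D" for x
    by (simp add: middle_piece_def D_def b power2_eq_square algebra_simps)
  have "(m * (w - xh))\<^sup>2 - D \<le> 0"
    using w sq[of w] m_pos by (simp add: phi_middle flip: sq) (simp add: mult_le_0_iff)
  then have "0 \<le> D" by (smt (verit) zero_le_power2)
  define r where "r = sqrt D / m"
  have r: "0 \<le> r" "D = m\<^sup>2 * r\<^sup>2"
    using \<open>0 \<le> D\<close> m_pos by (auto simp: r_def power_divide)
  have p: "p = xh - r"
    unfolding p_def D_def[symmetric] unfolding r_def b using m_pos by (simp add: field_simps)
  have twice: "2 * m * middle_piece x = 2 * m * (m / 2 * ((p - x) * (xh + r - x)))" for x
    unfolding sq r(2) p by (simp add: power2_eq_square algebra_simps)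
  have fact: "middle_piece x = m / 2 * ((p - x) * (xh + r - x))" for x
    using twice[of x] m_pos by simp
  have "p \<le> w"
  proof (rule ccontr)
    assume "\<not> p \<le> w"
    then have "0 < m / 2 * ((p - w) * (xh + r - w))"
      using m_pos r w by (intro mult_pos_pos) (auto simp: p)
    then show False using w fact[of w] by (simp add: phi_middle)
  qed
  have "0 < (p - yl) * (xh + r - yl)"
    using yl fact[of yl] m_pos y_left_less_y_right by (simp add: phi_middle zero_less_mult_iff)
  then have "yl < p"
    using r w by (auto simp: zero_less_mult_iff)
  have pos: "0 < \<phi> x" if "yl \<le> x" "x < p" for x
  proof -
    have "0 < m / 2 * ((p - x) * (xh + r - x))"
      using m_pos r that by (intro mult_pos_pos) (auto simp: p)
    then show ?thesis
      using that \<open>p \<le> w\<close> w fact[of x] by (simp add: phi_middle)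
  qed
  have "0 < \<phi> x" if "u \<le> x" "x < p" for x
    using that pos[of x] positive_up_to_y_left[OF fu yl, of x] by linarith
  then show ?thesis
    using \<open>yl < p\<close> \<open>p \<le> w\<close> w u_le_y_left y_right_le_v fact[of p] by (auto simp: phi_middle)
qed

lemma first_zero_on_right_piece:
  assumes fu: "0 < f u" and mid: "\<And>x. yl \<le> x \<Longrightarrow> x \<le> yr \<Longrightarrow> 0 < \<phi> x" and fv: "f v \<le> 0"
  defines "p \<equiv> v + 1 / m * (f' v + sqrt ((f' v)\<^sup>2 + 2 * m * f v))"
  shows "p \<in> {u..v} \<and> \<phi> p = 0 \<and> (\<forall>x\<in>{u..<p}. 0 < \<phi> x)"
proof -
  define D where "D = (f' v)\<^sup>2 + 2 * m * f v"
  define p' where "p' = v + 1 / m * (f' v - sqrt D)"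
  have sq: "2 * m * right_piece x = D - (m * (x - v) - f' v)\<^sup>2" for x
    by (simp add: right_piece_def D_def power2_eq_square algebra_simps)
  have yr: "0 < right_piece yr"
    using mid[of yr] y_left_less_y_right by (simp add: phi_right)
  then have "0 < D - (m * (yr - v) - f' v)\<^sup>2"
    using sq[of yr] m_pos by (simp flip: sq)
  then have "0 < D" by (smt (verit) zero_le_power2)
  then have D2: "(sqrt D)\<^sup>2 = D" by simp
  have "(sqrt D)\<^sup>2 - (m * (x - v) - f' v)\<^sup>2 = m\<^sup>2 * ((p - x) * (x - p'))" for x
    using m_pos unfolding p_def p'_def D_def[symmetric]
    by (simp add: power2_eq_square field_simps del: real_sqrt_mult_self)
  then have "D - (m * (x - v) - f' v)\<^sup>2 = m\<^sup>2 * ((p - x) * (x - p'))" for x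
    unfolding D2 by blast
  then have twice: "2 * m * right_piece x = 2 * m * (m / 2 * ((p - x) * (x - p')))" for x
    unfolding sq by (simp add: power2_eq_square)
  have fact: "right_piece x = m / 2 * ((p - x) * (x - p'))" for x
    using twice[of x] m_pos by simp
  have "p' < p"
    using m_pos \<open>0 < D\<close> divide_strict_right_mono[of "f' v - sqrt D" "f' v + sqrt D" m]
    by (simp add: p_def p'_def D_def[symmetric])
  moreover have "0 < (p - yr) * (yr - p')"
    using yr fact[of yr] m_pos by (simp add: zero_less_mult_iff)
  ultimately have p: "p' < yr" "yr < p"
    by (auto simp: zero_less_mult_iff)
  have "right_piece v \<le> 0" using fv by (simp add: right_piece_def)
  then have "(p - v) * (v - p') \<le> 0"
    using fact[of v] m_pos by (simp add: mult_le_0_iff)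
  then have "p \<le> v"
    using p y_right_le_v by (auto simp: mult_le_0_iff)
  have pos: "0 < \<phi> x" if "yr \<le> x" "x < p" for x
  proof -
    have "0 < right_piece x"
      unfolding fact using m_pos p that by (intro mult_pos_pos) auto
    then show ?thesis using that by (simp add: phi_right)
  qed
  have "0 < \<phi> x" if "u \<le> x" "x < p" for x
    using that pos[of x] mid[of x] positive_up_to_y_left[OF fu, of x] mid[of yl] y_left_less_y_right
    by linarith
  then show ?thesis
    using p \<open>p \<le> v\<close> y_left_less_y_right u_le_y_left fact[of p] by (auto simp: phi_right)
qed

text \<open>
  The case distinction of Step 5 finds the first piece on which \<open>phi\<close> becomes nonpositive.  The test
  point \<open>w\<close> is where the middle piece is smallest, or the right break point if there is no sign
  change; in the latter case, with \<open>phi\<close> positive at \<open>y_left\<close> and nonpositive at \<open>y_right\<close>, the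
  middle piece is decreasing and \<open>w\<close> is to the left of its vertex.
\<close>

lemma step5_point_is_first_zero:
  assumes fu: "0 < f u" and h: "is_h f f' m u v h" and R: "\<phi> h \<le> 0"
  defines "p \<equiv> step5_point f f' m u v"
  shows "p \<in> {u..v} \<and> \<phi> p = 0 \<and> (\<forall>x\<in>{u..<p}. 0 < \<phi> x)"
proof (cases "\<phi> yl \<le> 0")
  case True
  then show ?thesis
    using first_zero_on_left_piece[OF fu] by (simp add: p_def step5_point_def Let_def)
next
  case False
  then have yl: "0 < \<phi> yl" by simp
  define w where "w = (if sign_change f f' m u v then xh else yr)"
  have p: "p = (if \<phi> w > 0 then v + 1 / m * (f' v + sqrt ((f' v)\<^sup>2 + 2 * m * f v))
      else (- b_coeff f f' m u v
        - sqrt ((b_coeff f f' m u v)\<^sup>2 - 2 * m * c_coeff f f' m u v)) / m)"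
    using False by (simp add: p_def step5_point_def Let_def w_def)
  show ?thesis
  proof (cases "\<phi> w \<le> 0")
    case True
    have "yl < w" "w \<le> yr"
      using y_left_less_y_right by (auto simp: w_def sign_change_iff)
    moreover have "w \<le> xh"
    proof (rule ccontr)
      assume "\<not> w \<le> xh"
      then have "w = yr" "xh \<le> yl"
        by (auto simp: w_def sign_change_iff split: if_splits)
      then show False
        using phi_middle_mono(1)[of yl yr] True yl y_left_less_y_right by simp
    qed
    ultimately show ?thesis
      using first_zero_on_middle_piece[OF fu yl, of w] True p by simp
  next
    case False
    then have w: "0 < \<phi> w" by simp
    have "0 < \<phi> x" if x: "yl \<le> x" "x \<le> yr" for x
    proof (cases "sign_change f f' m u v")
      case True
      then show ?thesis
        using w x phi_middle_mono(1)[of xh x] phi_middle_mono(2)[of x xh]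
        by (cases "x \<le> xh") (auto simp: w_def sign_change_iff)
    next
      case False
      then show ?thesis
        using w yl x phi_middle_mono(1)[of yl x] phi_middle_mono(2)[of x yr]
        by (auto simp: w_def sign_change_iff not_less)
    qed
    moreover have "f v \<le> 0"
      using characteristic_eq[OF h] R fu w by (auto simp: w_def split: if_splits)
    ultimately show ?thesis
      using first_zero_on_right_piece[OF fu] w p by simp
  qed
qed

end

section \<open>The ordered trial points\<close>

lemma pt_in:
  assumes "finite T" "1 \<le> i" "i \<le> card T"
  shows "pt T i \<in> T"
  using assms nth_mem[of "i - 1" "sorted_list_of_set T"] by (auto simp: pt_def)

lemma pt_less_iff:
  assumes "finite T" "1 \<le> i" "i \<le> card T" "1 \<le> j" "j \<le> card T"
  shows "pt T i < pt T j \<longleftrightarrow> i < j"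
proof -
  have *: "pt T i < pt T j" if "i < j" "1 \<le> i" "j \<le> card T" for i j
    using that sorted_wrt_nth_less[OF strict_sorted_list_of_set[of T], of "i - 1" "j - 1"]
    by (auto simp: pt_def)
  show ?thesis
    using *[of i j] *[of j i] assms by (cases i j rule: linorder_cases) auto
qed

lemma pt_surj:
  assumes "finite T" "t \<in> T"
  obtains i where "1 \<le> i" "i \<le> card T" "pt T i = t"
proof -
  obtain j where "j < card T" "sorted_list_of_set T ! j = t"
    using assms by (metis in_set_conv_nth length_sorted_list_of_set set_sorted_list_of_set)
  then show thesis using that[of "Suc j"] by (auto simp: pt_def)
qed

lemma no_trial_point_between:
  assumes "finite T" "2 \<le> i" "i \<le> card T" "t \<in> T"
  shows "t \<le> pt T (i - 1) \<or> pt T i \<le> t"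
proof -
  obtain j where j: "1 \<le> j" "j \<le> card T" "pt T j = t"
    using pt_surj[OF assms(1,4)] .
  then show ?thesis
    using pt_less_iff[OF assms(1), of "i - 1" j] pt_less_iff[OF assms(1), of j i] assms
    by (auto simp: not_less[symmetric])
qed

lemma k_index_bounds:
  assumes "finite T"
  shows "k_index f T \<le> card T" "k_index f T = card T \<or> f (pt T (k_index f T)) < 0"
    and "0 < card T \<Longrightarrow> 1 \<le> k_index f T"
proof -
  let ?S = "{card T} \<union> {i. f (pt T i) < 0 \<and> 1 < i \<and> i \<le> card T}"
  have fin: "finite ?S" by simp
  show "k_index f T \<le> card T"
    unfolding k_index_def using fin by (intro Min_le) auto
  have "k_index f T \<in> ?S"
    unfolding k_index_def using fin by (intro Min_in) auto
  then show "k_index f T = card T \<or> f (pt T (k_index f T)) < 0"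
    and "0 < card T \<Longrightarrow> 1 \<le> k_index f T" by auto
qed

text \<open>
  Cutting off the search at the first trial point with a negative value never discards the first
  root \<open>xs\<close>, because such a point lies to its right.
\<close>

lemma interval_containing_first_root:
  assumes T: "finite T" and a: "a \<in> T" "a < xs" and b: "b \<in> T" "xs \<le> b"
    and pos: "\<And>x. x \<in> T \<Longrightarrow> x < xs \<Longrightarrow> 0 < f x"
  obtains j where "2 \<le> j" "j \<le> k_index f T" "pt T (j - 1) < xs" "xs \<le> pt T j"
proof -
  obtain ib where ib: "1 \<le> ib" "ib \<le> card T" "pt T ib = b"
    using pt_surj[OF T b(1)] .
  define j where "j = (LEAST i. 1 \<le> i \<and> i \<le> card T \<and> xs \<le> pt T i)"
  have j: "1 \<le> j" "j \<le> card T" "xs \<le> pt T j"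
    using LeastI[of "\<lambda>i. 1 \<le> i \<and> i \<le> card T \<and> xs \<le> pt T i" ib] ib b by (auto simp: j_def)
  have min: "pt T i < xs" if "1 \<le> i" "i < j" for i
  proof -
    have "\<not> (1 \<le> i \<and> i \<le> card T \<and> xs \<le> pt T i)"
      using that(2) unfolding j_def by (rule not_less_Least)
    then show ?thesis using that j by auto
  qed
  obtain ia where ia: "1 \<le> ia" "ia \<le> card T" "pt T ia = a"
    using pt_surj[OF T a(1)] .
  have "ia < j"
    using pt_less_iff[OF T ia(1,2) j(1,2)] ia a(2) j by linarith
  then have j2: "2 \<le> j" using ia by simp
  have k1: "1 \<le> k_index f T"
    using k_index_bounds(3)[OF T] j by simp
  have "j \<le> k_index f T"
  proof (rule ccontr)
    assume "\<not> j \<le> k_index f T"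
    then have "k_index f T < j" by simp
    then have "0 < f (pt T (k_index f T))"
      using pos min k1 j pt_in[OF T, of "k_index f T"] by auto
    then show False
      using k_index_bounds[OF T, of f] \<open>k_index f T < j\<close> j by auto
  qed
  with j2 min[of "j - 1"] j show thesis by (intro that[of j]) auto
qed

section \<open>Convergence of the trial points to the first root\<close>

locale root_search =
  fixes f f' :: "real \<Rightarrow> real" and a b K xs :: real
  assumes K_pos: "0 < K"
    and f_deriv: "\<And>x. x \<in> {a..b} \<Longrightarrow> (f has_real_derivative f' x) (at x within {a..b})"
    and f'_lipschitz: "\<And>x y. x \<in> {a..b} \<Longrightarrow> y \<in> {a..b} \<Longrightarrow> \<bar>f' x - f' y\<bar> \<le> K * \<bar>x - y\<bar>"
    and xs: "a < xs" "xs \<le> b" and root: "f xs = 0"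
    and positive_before: "\<And>x. a \<le> x \<Longrightarrow> x < xs \<Longrightarrow> 0 < f x"
begin

lemma trial_intervalI:
  assumes "u \<in> {a..b}" "v \<in> {a..b}" "u < v" "q_denom f' K u v \<noteq> 0"
  shows "trial_interval f f' K u v"
proof
  show "(f has_real_derivative f' z) (at z within {u..v})" if "z \<in> {u..v}" for z
    using f_deriv[of z] assms that by (auto intro: DERIV_subset)
  show "\<bar>f' y - f' z\<bar> \<le> K * \<bar>y - z\<bar>" if "y \<in> {u..v}" "z \<in> {u..v}" for y z
    using f'_lipschitz[of y z] assms that by auto
qed (use assms K_pos in auto)

text \<open>
  The effect of one iteration: the new point does not pass the first root, and the size of \<open>f\<close> there
  forces it away from all earlier trial points.
\<close>

lemma next_trial_point:
  assumes T: "finite T" "{a, b} \<subseteq> T" "T \<subseteq> {a..b}"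
    and q: "\<forall>i\<in>{2..k_index f T}. q_denom f' K (pt T (i - 1)) (pt T i) \<noteq> 0"
    and "next": "A1_next f f' K T i p"
  shows "p \<in> {a..xs}" and "t \<in> T \<Longrightarrow> f p \<le> K * (p - t)\<^sup>2"
proof -
  have int: "trial_interval f f' K (pt T (j - 1)) (pt T j)" if "j \<in> {2..k_index f T}" for j
  proof -
    have j: "1 \<le> j - 1" "j - 1 < j" "j \<le> card T"
      using that k_index_bounds(1)[OF T(1), of f] by auto
    then have "pt T (j - 1) \<in> {a..b}" "pt T j \<in> {a..b}" "pt T (j - 1) < pt T j"
      using subsetD[OF T(3) pt_in[OF T(1), of "j - 1"]] subsetD[OF T(3) pt_in[OF T(1), of j]]
        pt_less_iff[OF T(1), of "j - 1" j] by auto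
    then show ?thesis using q that by (intro trial_intervalI) auto
  qed
  obtain m h R where
    mhR: "\<forall>j\<in>{2..k_index f T}. m j = K \<and>
           is_h f f' (m j) (pt T (j - 1)) (pt T j) (h j) \<and>
           R j = phi f f' (m j) (pt T (j - 1)) (pt T j) (h j)"
    and i: "i \<in> {2..k_index f T}"
    and alt: "(((\<forall>j\<in>{2..<i}. R j > 0) \<and> R i \<le> 0 \<and>
            p = step5_point f f' (m i) (pt T (i - 1)) (pt T i))
         \<or> ((\<forall>j\<in>{2..k_index f T}. R j > 0) \<and> (\<forall>j\<in>{2..k_index f T}. R i \<le> R j) \<and>
            p = step4_point f f' (m i) (pt T (i - 1)) (pt T i) (h i)))"
    using "next" unfolding A1_next_def by blast
  have h: "is_h f f' K (pt T (j - 1)) (pt T j) (h j)"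
      "R j = phi f f' K (pt T (j - 1)) (pt T j) (h j)" if "j \<in> {2..k_index f T}" for j
    using mhR that by auto
  obtain j where j: "j \<in> {2..k_index f T}" "pt T (j - 1) < xs" "xs \<le> pt T j"
  proof (rule interval_containing_first_root[OF T(1), of a xs b f])
    show "0 < f x" if "x \<in> T" "x < xs" for x
      using that T(3) positive_before by auto
  qed (use T(2) xs in auto)
  have "R j \<le> phi f f' K (pt T (j - 1)) (pt T j) xs"
    using trial_interval.characteristic_le_phi[OF int[OF j(1)] h(1)[OF j(1)], of xs] j h by auto
  also have "\<dots> \<le> f xs"
    using trial_interval.phi_le_f[OF int[OF j(1)], of xs] j by auto
  finally have Rj: "R j \<le> 0" using root by simp
  (* Step 4 would need R j > 0, and in Step 5 no interval before the selected one has R \<le> 0. *)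
  with alt j(1) have step5: "R i \<le> 0" "p = step5_point f f' K (pt T (i - 1)) (pt T i)" "i \<le> j"
    using mhR i by (force simp: not_less[symmetric])+
  let ?u = "pt T (i - 1)" and ?v = "pt T i"
  interpret trial_interval f f' K ?u ?v by (rule int[OF i])
  have idx: "1 \<le> i - 1" "i - 1 \<le> card T" "i \<le> card T" "1 \<le> j - 1" "j - 1 \<le> card T"
    using i j k_index_bounds(1)[OF T(1), of f] by auto
  have uv: "?u \<in> {a..b}" "?v \<in> {a..b}"
    using subsetD[OF T(3) pt_in[OF T(1), of "i - 1"]] subsetD[OF T(3) pt_in[OF T(1), of i]] i idx
    by auto
  have "?u \<le> pt T (j - 1)"
    using pt_less_iff[OF T(1) idx(4,5) idx(1,2)] step5(3) by auto
  then have u: "?u < xs" using j by simp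
  then have "0 < f ?u" using positive_before uv by simp
  then have p: "p \<in> {?u..?v}" "\<phi> p = 0" "\<And>x. x \<in> {?u..<p} \<Longrightarrow> 0 < \<phi> x"
    using step5_point_is_first_zero[OF _ h(1)[OF i]] h(2)[OF i] step5 by auto
  have "p \<le> xs"
  proof (rule ccontr)
    assume "\<not> p \<le> xs"
    then have "0 < \<phi> xs" "\<phi> xs \<le> f xs"
      using p(1,3) u phi_le_f[of xs] by auto
    then show False using root by simp
  qed
  then show "p \<in> {a..xs}" using p uv by auto
  show "f p \<le> K * (p - t)\<^sup>2" if t: "t \<in> T"
  proof -
    consider "t \<le> ?u" | "?v \<le> t"
      using no_trial_point_between[OF T(1) _ _ t, of i] i idx by auto
    then show ?thesis
    proof cases
      case 1
      then have "(p - ?u)\<^sup>2 \<le> (p - t)\<^sup>2" using p by (intro power_mono) auto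
      then have "K * (p - ?u)\<^sup>2 \<le> K * (p - t)\<^sup>2" using K_pos by simp
      then show ?thesis using f_minus_phi_le(1)[OF p(1)] p(2) by linarith
    next
      case 2
      then have "(?v - p)\<^sup>2 \<le> (t - p)\<^sup>2" using p by (intro power_mono) auto
      then have "K * (p - ?v)\<^sup>2 \<le> K * (p - t)\<^sup>2"
        using K_pos by (simp add: power2_commute)
      then show ?thesis using f_minus_phi_le(2)[OF p(1)] p(2) by linarith
    qed
  qed
qed

lemma A1_sequence_trials:
  assumes "A1_sequence f f' a b K \<sigma> X"
  obtains n0 where "\<And>n. X n \<in> {a..b}" "\<And>n. n0 \<le> n \<Longrightarrow> X n \<in> {a..xs}"
    "\<And>n k. n0 \<le> n \<Longrightarrow> k < n \<Longrightarrow> f (X n) \<le> K * (X n - X k)\<^sup>2"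
proof -
  obtain n0 where init: "{a, b} \<subseteq> X ` {..<n0}" "X ` {..<n0} \<subseteq> {a..b}"
    and steps: "\<forall>n\<ge>n0. let T = X ` {..<n} in
         (\<forall>i\<in>{2..k_index f T}. q_denom f' K (pt T (i - 1)) (pt T i) \<noteq> 0) \<and>
         (\<exists>i. A1_next f f' K T i (X n) \<and> \<not> \<bar>pt T i - pt T (i - 1)\<bar> \<le> \<sigma>)"
    using assms unfolding A1_sequence_def by (elim exE conjE) (rule that)
  have step: "\<forall>i\<in>{2..k_index f (X ` {..<n})}.
        q_denom f' K (pt (X ` {..<n}) (i - 1)) (pt (X ` {..<n}) i) \<noteq> 0"
      "\<exists>i. A1_next f f' K (X ` {..<n}) i (X n)" if "n0 \<le> n" for n
    using steps[rule_format, OF that] by (auto simp only: Let_def)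
  have new: "X n \<in> {a..xs} \<and> (\<forall>k<n. f (X n) \<le> K * (X n - X k)\<^sup>2)"
    if n: "n0 \<le> n" "X ` {..<n} \<subseteq> {a..b}" for n
  proof -
    have ab: "{a, b} \<subseteq> X ` {..<n}"
      using init(1) n(1) image_mono[of "{..<n0}" "{..<n}" X] by auto
    obtain i where i: "A1_next f f' K (X ` {..<n}) i (X n)"
      using step(2)[OF n(1)] by blast
    show ?thesis
      using next_trial_point[OF _ ab n(2) step(1)[OF n(1)] i] by auto
  qed
  have all: "X ` {..<n} \<subseteq> {a..b}" for n
  proof (induction n)
    case (Suc n)
    show ?case
    proof (cases "n0 \<le> n")
      case True
      then show ?thesis using new[OF True Suc] Suc xs by (auto simp: lessThan_Suc)
    next
      case False
      then have "X ` {..<Suc n} \<subseteq> X ` {..<n0}" by (intro image_mono) auto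
      then show ?thesis using init(2) by blast
    qed
  qed simp
  show thesis
  proof (rule that[of n0])
    show "X n \<in> {a..b}" for n using all[of "Suc n"] by auto
  qed (use new all in blast)+
qed

text \<open>
  New trial points with \<open>X n \<le> xs - e\<close> are pairwise at least \<open>\<eta>\<close> apart, where \<open>K \<eta>\<^sup>2\<close> is the minimum of
  \<open>f\<close> on \<open>[a, xs - e]\<close>; infinitely many of them would contradict the compactness of \<open>[a, b]\<close>.
\<close>

lemma A1_sequence_tendsto:
  assumes "A1_sequence f f' a b K \<sigma> X"
  shows "X \<longlonglongrightarrow> xs"
proof -
  obtain n0 where X: "\<And>n. X n \<in> {a..b}" "\<And>n. n0 \<le> n \<Longrightarrow> X n \<in> {a..xs}"
    "\<And>n k. n0 \<le> n \<Longrightarrow> k < n \<Longrightarrow> f (X n) \<le> K * (X n - X k)\<^sup>2"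
    using A1_sequence_trials[OF assms] by blast
  have fin: "finite {n. n0 \<le> n \<and> X n \<le> xs - e}" (is "finite ?A") if e: "0 < e" for e
  proof (rule ccontr)
    assume inf: "infinite ?A"
    have "continuous_on {a..b} f"
      using f_deriv by (meson DERIV_continuous continuous_on_eq_continuous_within)
    then have cont: "continuous_on {a..xs - e} f"
      by (rule continuous_on_subset) (use xs e in auto)
    have "?A \<noteq> {}" using inf by force
    then have "{a..xs - e} \<noteq> {}"
      using X(2) by fastforce
    then obtain x0 where x0: "x0 \<in> {a..xs - e}" "\<And>x. x \<in> {a..xs - e} \<Longrightarrow> f x0 \<le> f x"
      using continuous_attains_inf[OF compact_Icc _ cont] by blast
    have f0: "0 < f x0" using x0(1) positive_before e by auto
    define \<eta> where "\<eta> = sqrt (f x0 / K)"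
    have \<eta>: "0 < \<eta>" using f0 K_pos by (simp add: \<eta>_def)
    obtain s :: "nat \<Rightarrow> nat" where s: "strict_mono s" "\<And>n. s n \<in> ?A"
      using infinite_enumerate[OF inf] by blast
    have sep: "\<eta> \<le> \<bar>X (s j) - X (s i)\<bar>" if "i < j" for i j
    proof -
      have "f x0 \<le> f (X (s j))"
        using s(2)[of j] X(2)[of "s j"] by (intro x0(2)) auto
      also have "\<dots> \<le> K * (X (s j) - X (s i))\<^sup>2"
        using s(2)[of j] strict_monoD[OF s(1) that] by (intro X(3)) auto
      finally have "f x0 / K \<le> (X (s j) - X (s i))\<^sup>2"
        using K_pos by (simp add: divide_le_eq mult.commute)
      then have "\<eta> \<le> sqrt ((X (s j) - X (s i))\<^sup>2)"
        unfolding \<eta>_def by (rule real_sqrt_le_mono)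
      then show ?thesis by simp
    qed
    have "\<forall>n. (X \<circ> s) n \<in> {a..b}" using X(1) by simp
    then obtain l r where r: "strict_mono r" "((X \<circ> s) \<circ> r) \<longlonglongrightarrow> l"
      using compact_Icc[of a b] unfolding compact_def by meson
    then have "Cauchy ((X \<circ> s) \<circ> r)" by (intro LIMSEQ_imp_Cauchy)
    then obtain M where "\<And>i j. i \<ge> M \<Longrightarrow> j \<ge> M \<Longrightarrow> dist (((X \<circ> s) \<circ> r) i) (((X \<circ> s) \<circ> r) j) < \<eta>"
      using \<eta> unfolding Cauchy_def by meson
    from this[of "Suc M" M] sep[of "r M" "r (Suc M)"] strict_monoD[OF r(1), of M "Suc M"]
    show False by (simp add: dist_real_def)
  qed
  show ?thesis
  proof (rule LIMSEQ_I)
    fix e :: real assume "0 < e"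
    then obtain B where B: "\<And>n. n \<in> {n. n0 \<le> n \<and> X n \<le> xs - e} \<Longrightarrow> n \<le> B"
      using finite_nat_set_iff_bounded_le[of "{n. n0 \<le> n \<and> X n \<le> xs - e}"] fin by blast
    have "norm (X n - xs) < e" if "max n0 (Suc B) \<le> n" for n
    proof -
      have "xs - e < X n" using B[of n] that by force
      then show ?thesis using X(2)[of n] that by auto
    qed
    then show "\<exists>N. \<forall>n\<ge>N. norm (X n - xs) < e" by blast
  qed
qed

end

lemma seq_limit_points_of_convergent:
  assumes "X \<longlonglongrightarrow> l"
  shows "seq_limit_points X = {l}"
proof -
  have "strict_mono (id :: nat \<Rightarrow> nat)" by (simp add: strict_mono_def)
  then have "l \<in> seq_limit_points X"
    using assms unfolding seq_limit_points_def by (auto intro!: exI[of _ id])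
  moreover have "l' = l" if "l' \<in> seq_limit_points X" for l'
    using that LIMSEQ_subseq_LIMSEQ[OF assms] LIMSEQ_unique
    unfolding seq_limit_points_def by blast
  ultimately show ?thesis by blast
qed

lemma first_root_exists:
  fixes f :: "real \<Rightarrow> real"
  assumes cont: "continuous_on {a..b} f" and "f a > 0" and root: "\<exists>x\<in>{a..b}. f x = 0"
  obtains xs where "a < xs" "xs \<le> b" "f xs = 0" "\<And>x. a \<le> x \<Longrightarrow> x < xs \<Longrightarrow> 0 < f x"
proof -
  let ?Z = "{a..b} \<inter> f -` {0}"
  have "closed ?Z" by (rule continuous_closed_preimage[OF cont]) auto
  moreover have "bounded ?Z" by (rule bounded_subset[OF bounded_closed_interval]) auto
  ultimately have "compact ?Z" by (simp add: compact_eq_bounded_closed)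
  moreover have "?Z \<noteq> {}" using root by auto
  ultimately obtain xs where xs: "xs \<in> ?Z" "\<And>x. x \<in> ?Z \<Longrightarrow> xs \<le> x"
    using compact_attains_inf[of ?Z] by blast
  have "0 < f x" if x: "a \<le> x" "x < xs" for x
  proof (rule ccontr)
    assume "\<not> 0 < f x"
    moreover have "continuous_on {a..x} f"
      by (rule continuous_on_subset[OF cont]) (use x xs(1) in auto)
    ultimately obtain z where "a \<le> z" "z \<le> x" "f z = 0"
      using IVT2'[of f x 0 a] x \<open>f a > 0\<close> by auto
    then show False using xs(2)[of z] xs(1) x by auto
  qed
  moreover have "xs \<noteq> a" using xs(1) \<open>f a > 0\<close> by auto
  ultimately show thesis using xs(1) by (intro that[of xs]) auto
qed

theorem theorem1:
  fixes f f' :: "real \<Rightarrow> real" and a b K L :: real and X :: "nat \<Rightarrow> real"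
  assumes "a < b"
    and "\<And>x. x \<in> {a..b} \<Longrightarrow> (f has_real_derivative f' x) (at x within {a..b})"
    and "f a > 0"
    and "\<And>x y. x \<in> {a..b} \<Longrightarrow> y \<in> {a..b} \<Longrightarrow> \<bar>f' x - f' y\<bar> \<le> L * \<bar>x - y\<bar>"
    and "0 < L" and "L \<le> K"
    and "A1_sequence f f' a b K 0 X"
    and "\<exists>x\<in>{a..b}. f x = 0"
  shows "\<exists>xstar. xstar \<in> {a..b} \<and> f xstar = 0 \<and> (\<forall>x\<in>{a..b}. f x = 0 \<longrightarrow> xstar \<le> x) \<and>
           seq_limit_points X = {xstar}"
proof -
  have "continuous_on {a..b} f"
    using assms(2) by (meson DERIV_continuous continuous_on_eq_continuous_within)
  then obtain xs where first: "a < xs" "xs \<le> b" "f xs = 0" "\<And>x. a \<le> x \<Longrightarrow> x < xs \<Longrightarrow> 0 < f x"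
    using first_root_exists assms(3,8) by blast
  interpret root_search f f' a b K xs
  proof
    show "\<bar>f' x - f' y\<bar> \<le> K * \<bar>x - y\<bar>" if "x \<in> {a..b}" "y \<in> {a..b}" for x y
      using assms(4)[OF that] mult_right_mono[OF assms(6), of "\<bar>x - y\<bar>"] by linarith
  qed (use assms first in auto)
  have "seq_limit_points X = {xs}"
    using A1_sequence_tendsto[OF assms(7)] by (rule seq_limit_points_of_convergent)
  moreover have "xs \<le> x" if "x \<in> {a..b}" "f x = 0" for x
    using first(4)[of x] that by force
  ultimately show ?thesis
    using first by (intro exI[of _ xs]) auto
qed

end
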